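(* Let $A=(a_{ij})\in\mathbb{R}^{m_1\times m_2}$ have nonnegative entries and let $b\in\mathbb{R}^{m_1}$ have all entries strictly positive. For any $x_0\in\mathbb{R}^{m_2}$ with all entries strictly positive, let $(x_n)_{n\ge0}$ be defined by $$x_{n+1,j}=\frac{x_{n,j}}{a_{\cdot j}}\sum_{i=1}^{m_1} a_{ij}\frac{b_i}{b_{n,i}},\qquad 1\le j\le m_2,\ n\ge 0,\qquad\text{where } b_n=(b_{n,i})_{i=1}^{m_1}=Ax_n .$$ Then $$D(b,Ax_n)\downarrow\inf_x D(b,Ax)\qquad\text{as } n\to\infty,$$ where $x$ ranges over all vectors in $\mathbb{R}^{m_2}$ with all entries strictly positive and $\sum_{j}x_ja_{\cdot j}=b_\cdot$.
   Context: Notation: $a_{\cdot j}=\sum_i a_{ij}$ is the $j$th column sum of $A$ and $b_\cdot=\sum_i b_i$. The symbol $\downarrow$ denotes monotone (nonincreasing) convergence. For entrywise nonnegative vectors $u,v$ of the same dimension, the Kullback--Leibler divergence is $D(u,v)=\sum_{i} u_i\log(u_i/v_i)$, where a term with $u_i=0$ is taken to be $0$, and $D(u,v)=\infty$ if $u_i>0$ and $v_i=0$ for some $i$.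
   Formalization: Monotonicity is claimed only for n ≥ 1, and from n = 0 when x_0 satisfies Σ_j x_{0,j} a_{·j} = b_·; for arbitrary positive x_0 the first step can increase D (A = b = 1, x_0 = 10). Convergence to the infimum is for every positive x_0. *)

theory Defs
  imports "HOL-Analysis.Analysis"
begin

(* Intended for entrywise nonnegative vectors.  The vectors are not normalised,
   so the value may be a negative real number. *)
definition KL :: "real ^ 'm \<Rightarrow> real ^ 'm \<Rightarrow> ereal" where
  "KL u v = (if \<exists>i. u $ i > 0 \<and> v $ i = 0 then \<infinity>
             else ereal (\<Sum>i\<in>UNIV. if u $ i = 0 then 0 else u $ i * ln (u $ i / v $ i)))"

definition col_sum :: "real ^ 'n ^ 'm \<Rightarrow> 'n \<Rightarrow> real" where
  "col_sum A j = (\<Sum>i\<in>UNIV. A $ i $ j)"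

end

theory Submission
  imports Defs
begin

text \<open>
  The update \<open>x \<mapsto> x'\<close> is an alternating minimisation of \<open>D(q, p)\<close>, where \<open>q\<close> has row sums \<open>b\<close>
  and \<open>p\<^sub>i\<^sub>j = a\<^sub>i\<^sub>j x\<^sub>j\<close>.  Let \<open>y\<close> be feasible and let \<open>q\<^sub>i\<^sub>j = b\<^sub>i a\<^sub>i\<^sub>j y\<^sub>j / (Ay)\<^sub>i\<close>, with column sums \<open>w\<^sub>j\<close>.
  Applying \<open>ln t \<ge> 1 - 1/t\<close> to every entry gives
  \<open>D(b, Ax) - D(b, Ay) \<le> (\<Sum>j. w\<^sub>j ln (x'\<^sub>j / x\<^sub>j))\<close>.
  The right-hand side telescopes along the iteration and its partial sums are bounded, because
  all iterates \<open>x\<^sub>n\<close> with \<open>n \<ge> 1\<close> have the same total mass.  Since \<open>D(b, Ax\<^sub>n)\<close> decreases,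
  its limit cannot exceed \<open>D(b, Ay)\<close>.
\<close>

section \<open>Elementary inequalities and the divergence of positive vectors\<close>

lemma one_minus_inverse_le_ln:
  fixes t :: real
  assumes "t > 0"
  shows "1 - 1 / t \<le> ln t"
  using ln_le_minus_one[of "1 / t"] assms by (simp add: ln_div)

text \<open>If \<open>c\<close> exceeded \<open>d\<close>, each step would raise \<open>V\<close> by
  at least the fixed amount \<open>c - d\<close>, so \<open>V\<close> would outgrow
  \<open>K\<close>.\<close>

lemma le_of_telescoping_bound:
  fixes f V :: "nat \<Rightarrow> real"
  assumes step: "\<And>n. f n - d \<le> V (Suc n) - V n"
    and bound: "\<And>n. V n \<le> K"
    and lower: "\<And>n. c \<le> f n"
  shows "c \<le> d"
proof (rule ccontr)
  assume "\<not> c \<le> d"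
  then have pos: "c - d > 0" by simp
  have lin: "real n * (c - d) \<le> V n - V 0" for n
  proof (induction n)
    case (Suc n)
    have "real (Suc n) * (c - d) = real n * (c - d) + (c - d)"
      by (simp add: algebra_simps)
    with Suc step[of n] lower[of n] show ?case by linarith
  qed simp
  obtain n where "K - V 0 < real n * (c - d)"
    using ex_less_of_nat_mult[OF pos] by blast
  with lin[of n] bound[of n] show False by linarith
qed

lemma KL_eq_top:
  assumes "u $ i > 0" "v $ i = 0"
  shows "KL u v = \<infinity>"
  using assms by (auto simp: KL_def)

lemma KL_positive:
  assumes "\<And>i. u $ i > 0" "\<And>i. v $ i > 0"
  shows "KL u v = ereal (\<Sum>i\<in>UNIV. u $ i * ln (u $ i / v $ i))"
proof -
  have "u $ i \<noteq> 0" "v $ i \<noteq> 0" for i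
    using assms[of i] by auto
  then show ?thesis by (simp add: KL_def)
qed

section \<open>The multiplicative update and its weights\<close>

definition mass :: "real ^ 'n ^ 'm \<Rightarrow> real ^ 'n \<Rightarrow> real" where
  "mass A x = (\<Sum>j\<in>UNIV. x $ j * col_sum A j)"

text \<open>For positive \<open>A *v x\<close>, this is the minimiser of the divergence from the
  matrix \<open>A $ i $ j * x $ j\<close> among nonnegative matrices with row sums
  \<open>b\<close>.\<close>

definition em_weight :: "real ^ 'n ^ 'm \<Rightarrow> real ^ 'm \<Rightarrow> real ^ 'n \<Rightarrow> 'm \<Rightarrow> 'n \<Rightarrow> real" where
  "em_weight A b x i j = b $ i * A $ i $ j * x $ j / (A *v x) $ i"

definition em_step :: "real ^ 'n ^ 'm \<Rightarrow> real ^ 'm \<Rightarrow> real ^ 'n \<Rightarrow> real ^ 'n" where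
  "em_step A b x =
     (\<chi> j. x $ j / col_sum A j * (\<Sum>i\<in>UNIV. A $ i $ j * (b $ i / (A *v x) $ i)))"

text \<open>Entries belonging to a zero column are unconstrained apart from their sign: division by the
  zero column sum makes them vanish after one step.\<close>

definition admissible :: "real ^ 'n ^ 'm \<Rightarrow> real ^ 'n \<Rightarrow> bool" where
  "admissible A x \<longleftrightarrow> (\<forall>j. x $ j \<ge> 0 \<and> (col_sum A j > 0 \<longrightarrow> x $ j > 0))"

text \<open>Nonzero rows keep \<open>A *v x\<close> positive, so that the divergences are finite. A
  zero row makes them all infinite; the final theorem treats that case separately.\<close>

locale positive_inverse_problem =
  fixes A :: "real ^ 'n ^ 'm" and b :: "real ^ 'm"
  assumes A_nonneg: "A $ i $ j \<ge> 0"
    and b_pos: "b $ i > 0"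
    and row_nonzero: "\<exists>j. A $ i $ j \<noteq> 0"
begin

abbreviation total :: real where
  "total \<equiv> \<Sum>i\<in>UNIV. b $ i"

lemma col_sum_nonneg: "col_sum A j \<ge> 0"
  by (simp add: col_sum_def A_nonneg sum_nonneg)

lemma col_sum_pos:
  assumes "A $ i $ j \<noteq> 0"
  shows "col_sum A j > 0"
  unfolding col_sum_def
  using assms A_nonneg[of i j] by (intro sum_pos2[where i = i]) (simp_all add: A_nonneg less_le)

lemma zero_column:
  assumes "\<not> col_sum A j > 0"
  shows "A $ i $ j = 0"
  using assms col_sum_pos by blast

lemma mult_vec_pos:
  assumes "admissible A x"
  shows "(A *v x) $ i > 0"
proof -
  obtain j where j: "A $ i $ j \<noteq> 0" using row_nonzero by blast
  then have "A $ i $ j * x $ j > 0"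
    using assms A_nonneg[of i j] col_sum_pos[OF j]
    by (auto simp: admissible_def intro!: mult_pos_pos)
  then show ?thesis
    using assms A_nonneg
    by (auto simp: matrix_vector_mult_def admissible_def intro!: sum_pos2[where i = j])
qed

lemma KL_admissible:
  assumes "admissible A x"
  shows "KL b (A *v x) = ereal (\<Sum>i\<in>UNIV. b $ i * ln (b $ i / (A *v x) $ i))"
  by (rule KL_positive[OF b_pos mult_vec_pos[OF assms]])

lemma em_weight_nonneg:
  assumes "admissible A x"
  shows "em_weight A b x i j \<ge> 0"
  using assms A_nonneg[of i j] b_pos[of i] mult_vec_pos[OF assms, of i]
  by (auto simp: em_weight_def admissible_def)

lemma em_weight_row_sum:
  assumes "admissible A x"
  shows "(\<Sum>j\<in>UNIV. em_weight A b x i j) = b $ i"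
proof -
  have "(\<Sum>j\<in>UNIV. em_weight A b x i j) = b $ i * (A *v x) $ i / (A *v x) $ i"
    by (simp add: em_weight_def matrix_vector_mult_def sum_divide_distrib sum_distrib_left
        mult.assoc)
  then show ?thesis using mult_vec_pos[OF assms, of i] by simp
qed

text \<open>The update is chosen to match column sums: the matrix \<open>A $ i $ j * x' $ j\<close>,
  with \<open>x'\<close> the updated vector, has those of the weights.\<close>

lemma em_weight_col_sum:
  "(\<Sum>i\<in>UNIV. em_weight A b x i j) = col_sum A j * em_step A b x $ j"
proof (cases "col_sum A j > 0")
  case True
  then show ?thesis
    by (simp add: em_weight_def em_step_def sum_distrib_left algebra_simps)
next
  case False
  then show ?thesis
    using zero_column[OF False] col_sum_nonneg[of j] by (simp add: em_weight_def)
qed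

lemma sum_em_weight_col:
  "(\<Sum>i\<in>UNIV. \<Sum>j\<in>UNIV. em_weight A b x i j * f j) =
     (\<Sum>j\<in>UNIV. col_sum A j * em_step A b x $ j * f j)"
  by (subst sum.swap) (simp add: sum_distrib_right[symmetric] em_weight_col_sum)

lemma sum_em_weight_row:
  assumes "admissible A x"
  shows "(\<Sum>i\<in>UNIV. \<Sum>j\<in>UNIV. em_weight A b x i j * f i) = (\<Sum>i\<in>UNIV. b $ i * f i)"
  by (simp add: sum_distrib_right[symmetric] em_weight_row_sum[OF assms])

lemma admissible_em_step:
  assumes "admissible A x"
  shows "admissible A (em_step A b x)"
proof -
  have pos: "em_step A b x $ j > 0" if c: "col_sum A j > 0" for j
  proof -
    obtain i where i: "A $ i $ j \<noteq> 0"
      using c unfolding col_sum_def by (metis less_irrefl sum.neutral)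
    have "(\<Sum>i\<in>UNIV. A $ i $ j * (b $ i / (A *v x) $ i)) > 0"
      using i A_nonneg b_pos mult_vec_pos[OF assms]
      by (intro sum_pos2[where i = i]) (auto simp: less_le intro!: divide_nonneg_nonneg)
    then show ?thesis
      using assms c by (auto simp: em_step_def admissible_def)
  qed
  have "em_step A b x $ j = 0" if "\<not> col_sum A j > 0" for j
    using zero_column[OF that] by (simp add: em_step_def)
  with pos show ?thesis
    unfolding admissible_def by (metis less_imp_le order_refl)
qed

text \<open>Both sides are the sum of all weights, taken by columns and by rows. Hence one step
  restores the mass constraint whatever the mass of \<open>x\<close>.\<close>

lemma mass_em_step:
  assumes "admissible A x"
  shows "mass A (em_step A b x) = total"
  using sum_em_weight_col[of x "\<lambda>_. 1"] sum_em_weight_row[OF assms, of "\<lambda>_. 1"]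
  by (simp add: mass_def mult.commute)

section \<open>Entropy inequalities for one update\<close>

text \<open>The decrease is at least the divergence between the column masses of the new and the old
  vector, which is nonnegative.\<close>

lemma KL_em_step_le:
  assumes adm: "admissible A x" and mass: "mass A x = total"
  shows "KL b (A *v em_step A b x) \<le> KL b (A *v x)"
proof -
  define x' where "x' = em_step A b x"
  have adm': "admissible A x'" using admissible_em_step[OF adm] by (simp add: x'_def)
  let ?q = "em_weight A b x" and ?q' = "em_weight A b x'"
  define u where "u i = ln ((A *v x') $ i / (A *v x) $ i)" for i
  define g where "g j = ln (x' $ j / x $ j)" for j
  have entry: "?q i j - b $ i * A $ i $ j * x' $ j / (A *v x') $ i \<le> ?q i j * (u i - g j)" for i j
  proof (cases "A $ i $ j = 0")
    case True
    then show ?thesis by (simp add: em_weight_def)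
  next
    case False
    have x: "x $ j > 0" "x' $ j > 0"
      using adm adm' col_sum_pos[OF False] by (auto simp: admissible_def)
    have Ax: "(A *v x) $ i > 0" "(A *v x') $ i > 0"
      using mult_vec_pos adm adm' by auto
    \<comment> \<open>This is the ratio \<open>?q i j / ?q' i j\<close>; summing the entries yields
      nonnegativity of the divergence of \<open>?q\<close> from \<open>?q'\<close>.\<close>
    let ?t = "(A *v x') $ i / (A *v x) $ i / (x' $ j / x $ j)"
    have t: "?t > 0" using x Ax by simp
    have "u i - g j = ln ?t"
      using x Ax by (simp add: u_def g_def ln_div ln_mult)
    then have "?q i j * (1 - 1 / ?t) \<le> ?q i j * (u i - g j)"
      using one_minus_inverse_le_ln[OF t] em_weight_nonneg[OF adm] by (simp add: mult_left_mono)
    moreover have "?q i j * (1 - 1 / ?t) = ?q i j - b $ i * A $ i $ j * x' $ j / (A *v x') $ i"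
      using x Ax by (simp add: em_weight_def field_simps)
    ultimately show ?thesis by simp
  qed
  have "(\<Sum>i\<in>UNIV. \<Sum>j\<in>UNIV. ?q i j - ?q' i j) \<le> (\<Sum>i\<in>UNIV. \<Sum>j\<in>UNIV. ?q i j * (u i - g j))"
    using entry by (intro sum_mono) (simp add: em_weight_def)
  moreover have "(\<Sum>i\<in>UNIV. \<Sum>j\<in>UNIV. ?q i j - ?q' i j) = 0"
    by (simp add: sum_subtractf em_weight_row_sum[OF adm] em_weight_row_sum[OF adm'])
  ultimately have "(\<Sum>j\<in>UNIV. col_sum A j * x' $ j * g j) \<le> (\<Sum>i\<in>UNIV. b $ i * u i)"
    by (simp add: right_diff_distrib sum_subtractf sum_em_weight_row[OF adm] sum_em_weight_col
        x'_def)
  \<comment> \<open>The sum is the divergence of the column masses of \<open>x'\<close> from those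
    of \<open>x\<close>; equality of the two totals makes it nonnegative.\<close>
  moreover have "(\<Sum>j\<in>UNIV. col_sum A j * x' $ j * g j) \<ge> 0"
  proof -
    have "col_sum A j * x' $ j - col_sum A j * x $ j \<le> col_sum A j * x' $ j * g j" for j
    proof (cases "col_sum A j > 0")
      case True
      then have x: "x $ j > 0" "x' $ j > 0"
        using adm adm' by (auto simp: admissible_def)
      have "1 - 1 / (x' $ j / x $ j) \<le> g j"
        unfolding g_def using x by (intro one_minus_inverse_le_ln) simp
      then have "col_sum A j * x' $ j * (1 - 1 / (x' $ j / x $ j)) \<le> col_sum A j * x' $ j * g j"
        using True x by (intro mult_left_mono) auto
      moreover have "x' $ j * (1 - 1 / (x' $ j / x $ j)) = x' $ j - x $ j"
        using x by (simp add: field_simps)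
      ultimately show ?thesis by (simp only: mult.assoc flip: right_diff_distrib)
    next
      case False
      then show ?thesis using col_sum_nonneg[of j] by simp
    qed
    then have "(\<Sum>j\<in>UNIV. col_sum A j * x' $ j - col_sum A j * x $ j)
        \<le> (\<Sum>j\<in>UNIV. col_sum A j * x' $ j * g j)"
      by (intro sum_mono)
    moreover have "(\<Sum>j\<in>UNIV. col_sum A j * x' $ j - col_sum A j * x $ j) = mass A x' - mass A x"
      by (simp add: mass_def sum_subtractf mult.commute)
    ultimately show ?thesis
      using mass mass_em_step[OF adm] by (simp add: x'_def)
  qed
  moreover have "b $ i * ln (b $ i / (A *v x') $ i) = b $ i * ln (b $ i / (A *v x) $ i) - b $ i * u i" for i
    using b_pos[of i] mult_vec_pos[OF adm, of i] mult_vec_pos[OF adm', of i]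
    by (simp add: u_def ln_div algebra_simps)
  ultimately show ?thesis
    by (simp add: KL_admissible adm adm' sum_subtractf flip: x'_def)
qed

text \<open>The five-point inequality of Csiszar and Tusnady for this alternating minimisation.\<close>

lemma KL_diff_le:
  assumes adm: "admissible A x" and adm_y: "admissible A y" and mass: "mass A y = total"
  shows "(\<Sum>i\<in>UNIV. b $ i * ln (b $ i / (A *v x) $ i)) - (\<Sum>i\<in>UNIV. b $ i * ln (b $ i / (A *v y) $ i))
    \<le> (\<Sum>j\<in>UNIV. col_sum A j * em_step A b y $ j * (ln (em_step A b x $ j) - ln (x $ j)))"
proof -
  define x' where "x' = em_step A b x"
  have adm': "admissible A x'" using admissible_em_step[OF adm] by (simp add: x'_def)
  let ?q = "em_weight A b y"
  define u where "u i = ln (b $ i / (A *v x) $ i) - ln (b $ i / (A *v y) $ i)" for i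
  define g where "g j = ln (x' $ j) - ln (x $ j)" for j
  \<comment> \<open>The weights of \<open>x\<close>, with each column rescaled so that its sum
    becomes the column mass of \<open>y\<close>.\<close>
  define r where "r i j = em_weight A b x i j * y $ j / x' $ j" for i j
  have entry: "?q i j - r i j \<le> ?q i j * (g j - u i)" for i j
  proof (cases "A $ i $ j = 0")
    case True
    then show ?thesis by (simp add: em_weight_def r_def)
  next
    case False
    have x: "x $ j > 0" "x' $ j > 0"
      using adm adm' col_sum_pos[OF False] by (auto simp: admissible_def)
    have Ax: "(A *v x) $ i > 0" "(A *v y) $ i > 0"
      using mult_vec_pos adm adm_y by auto
    \<comment> \<open>This is the ratio \<open>?q i j / r i j\<close>.\<close>
    let ?t = "x' $ j / x $ j * ((A *v x) $ i / (A *v y) $ i)"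
    have t: "?t > 0" using x Ax by simp
    have "g j - u i = ln ?t"
      using x Ax b_pos[of i] by (simp add: u_def g_def ln_div ln_mult)
    then have "?q i j * (1 - 1 / ?t) \<le> ?q i j * (g j - u i)"
      using one_minus_inverse_le_ln[OF t] em_weight_nonneg[OF adm_y] by (simp add: mult_left_mono)
    moreover have "?q i j * (1 - 1 / ?t) = ?q i j - r i j"
      using x Ax by (simp add: em_weight_def r_def field_simps)
    ultimately show ?thesis by simp
  qed
  have r_col: "(\<Sum>i\<in>UNIV. r i j) = y $ j * col_sum A j" for j
  proof (cases "col_sum A j > 0")
    case True
    then have "x' $ j > 0" using adm' by (simp add: admissible_def)
    moreover have "(\<Sum>i\<in>UNIV. r i j) = (\<Sum>i\<in>UNIV. em_weight A b x i j) * y $ j / x' $ j"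
      by (simp add: r_def sum_distrib_right sum_divide_distrib)
    ultimately show ?thesis by (simp add: em_weight_col_sum x'_def)
  next
    case False
    then show ?thesis
      using zero_column[OF False] col_sum_nonneg[of j] by (simp add: r_def em_weight_def)
  qed
  \<comment> \<open>Feasibility of \<open>y\<close> enters here: it gives \<open>r\<close> the same
    total as \<open>?q\<close>, so the linear terms cancel.\<close>
  have "(\<Sum>i\<in>UNIV. \<Sum>j\<in>UNIV. r i j) = total"
    by (subst sum.swap) (use mass in \<open>simp add: r_col mass_def\<close>)
  then have "(\<Sum>i\<in>UNIV. \<Sum>j\<in>UNIV. ?q i j - r i j) = 0"
    by (simp add: sum_subtractf em_weight_row_sum[OF adm_y])
  moreover have "(\<Sum>i\<in>UNIV. \<Sum>j\<in>UNIV. ?q i j - r i j) \<le> (\<Sum>i\<in>UNIV. \<Sum>j\<in>UNIV. ?q i j * (g j - u i))"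
    using entry by (intro sum_mono)
  ultimately have "(\<Sum>i\<in>UNIV. b $ i * u i) \<le> (\<Sum>j\<in>UNIV. col_sum A j * em_step A b y $ j * g j)"
    by (simp add: right_diff_distrib sum_subtractf sum_em_weight_row[OF adm_y] sum_em_weight_col)
  then show ?thesis
    by (simp add: u_def g_def x'_def right_diff_distrib sum_subtractf)
qed

section \<open>Convergence to the infimum\<close>

lemma KL_lower_bound:
  assumes adm: "\<And>n. admissible A (z n)" and mass: "\<And>n. mass A (z n) = total"
    and step: "\<And>n. z (Suc n) = em_step A b (z n)"
    and adm_y: "admissible A y" and mass_y: "mass A y = total"
  shows "(INF n. KL b (A *v z n)) \<le> KL b (A *v y)"
proof (rule ccontr)
  let ?I = "INF n. KL b (A *v z n)"
  define f where "f n = (\<Sum>i\<in>UNIV. b $ i * ln (b $ i / (A *v z n) $ i))" for n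
  define d where "d = (\<Sum>i\<in>UNIV. b $ i * ln (b $ i / (A *v y) $ i))"
  define w where "w j = col_sum A j * em_step A b y $ j" for j
  \<comment> \<open>Up to sign and an additive constant, \<open>V n\<close> is the divergence of
    \<open>w\<close> from the column masses of \<open>z n\<close>.\<close>
  define V where "V n = (\<Sum>j\<in>UNIV. w j * ln (z n $ j))" for n
  assume "\<not> ?I \<le> KL b (A *v y)"
  then have "ereal d < ?I"
    by (simp add: KL_admissible[OF adm_y] d_def not_le)
  moreover have le: "?I \<le> ereal (f n)" for n
    using KL_admissible[OF adm] by (auto simp: f_def intro!: INF_lower2[of n])
  ultimately obtain c where c: "?I = ereal c" "d < c"
    using le[of 0] by (cases ?I) auto
  have "c \<le> d"
  proof (rule le_of_telescoping_bound)
    show "f n - d \<le> V (Suc n) - V n" for n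
      using KL_diff_le[OF adm[of n] adm_y mass_y]
      by (simp add: f_def d_def V_def w_def step right_diff_distrib sum_subtractf)
    show "V n \<le> (\<Sum>j\<in>UNIV. w j * ln (total / col_sum A j))" for n
      unfolding V_def
    proof (rule sum_mono)
      fix j
      show "w j * ln (z n $ j) \<le> w j * ln (total / col_sum A j)"
      proof (cases "col_sum A j > 0")
        case True
        have pos: "z n $ j > 0" using adm[of n] True by (simp add: admissible_def)
        \<comment> \<open>One column mass is at most the total, which bounds the coordinate
          uniformly in \<open>n\<close>.\<close>
        have "z n $ j * col_sum A j \<le> mass A (z n)"
          unfolding mass_def using adm[of n] col_sum_nonneg
          by (intro member_le_sum) (auto simp: admissible_def)
        then have "z n $ j \<le> total / col_sum A j"
          using True by (simp add: mass pos_le_divide_eq)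
        then have "ln (z n $ j) \<le> ln (total / col_sum A j)"
          using pos by simp
        moreover have "w j \<ge> 0"
          using True admissible_em_step[OF adm_y] by (simp add: w_def admissible_def)
        ultimately show ?thesis by (rule mult_left_mono)
      next
        case False
        then show ?thesis using col_sum_nonneg[of j] by (simp add: w_def)
      qed
    qed
    show "c \<le> f n" for n
      using le[of n] c by simp
  qed
  with c show False by simp
qed

text \<open>Iterates vanish on zero columns after a step and so may lie outside the set of the
  infimum. Putting 1 there changes neither the image nor the mass.\<close>

lemma positive_representative:
  assumes "admissible A x"
  obtains y where "\<And>j. y $ j > 0" "A *v y = A *v x" "mass A y = mass A x"
proof
  define y where "y = (\<chi> j. if col_sum A j > 0 then x $ j else 1)"
  show "y $ j > 0" for j
    using assms by (simp add: y_def admissible_def)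
  have "A $ i $ j * y $ j = A $ i $ j * x $ j" for i j
    using zero_column[of j i] by (simp add: y_def)
  then show "A *v y = A *v x"
    by (simp only: matrix_vector_mult_def)
  have "y $ j * col_sum A j = x $ j * col_sum A j" for j
    using col_sum_nonneg[of j] by (auto simp: y_def)
  then show "mass A y = mass A x"
    by (simp only: mass_def)
qed

lemma KL_em_iteration:
  assumes adm: "\<And>n. admissible A (z n)" and mass: "\<And>n. mass A (z n) = total"
    and step: "\<And>n. z (Suc n) = em_step A b (z n)"
  shows "decseq (\<lambda>n. KL b (A *v z n))"
    and "(\<lambda>n. KL b (A *v z n)) \<longlonglongrightarrow>
      (INF y \<in> {y. (\<forall>j. y $ j > 0) \<and> mass A y = total}. KL b (A *v y))"
proof -
  show dec: "decseq (\<lambda>n. KL b (A *v z n))"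
    by (rule decseq_SucI) (simp add: step KL_em_step_le adm mass)
  have "(INF n. KL b (A *v z n)) =
      (INF y \<in> {y. (\<forall>j. y $ j > 0) \<and> mass A y = total}. KL b (A *v y))"
  proof (rule antisym)
    show "(INF n. KL b (A *v z n)) \<le>
        (INF y \<in> {y. (\<forall>j. y $ j > 0) \<and> mass A y = total}. KL b (A *v y))"
      using KL_lower_bound[where z = z, OF adm mass step]
      by (intro INF_greatest) (auto simp: admissible_def less_imp_le)
    show "(INF y \<in> {y. (\<forall>j. y $ j > 0) \<and> mass A y = total}. KL b (A *v y)) \<le>
        (INF n. KL b (A *v z n))"
    proof (rule INF_greatest)
      fix n
      obtain y where "\<And>j. y $ j > 0" "A *v y = A *v z n" "mass A y = mass A (z n)"
        using positive_representative[OF adm] by blast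
      then show "(INF y \<in> {y. (\<forall>j. y $ j > 0) \<and> mass A y = total}. KL b (A *v y))
          \<le> KL b (A *v z n)"
        by (intro INF_lower2[of y]) (auto simp: mass)
    qed
  qed
  with LIMSEQ_INF[OF dec] show "(\<lambda>n. KL b (A *v z n)) \<longlonglongrightarrow>
      (INF y \<in> {y. (\<forall>j. y $ j > 0) \<and> mass A y = total}. KL b (A *v y))"
    by simp
qed

end

text \<open>The initial vector may have the wrong mass, and then the first step can increase the
  divergence: with all dimensions 1, \<open>A\<close> and \<open>b\<close> equal to 1 and
  \<open>x 0\<close> equal to 2, it rises from -ln 2 to 0. Monotonicity is therefore stated from
  index 1, and from index 0 for a feasible start.\<close>

theorem theorem2p3:
  fixes A :: "real ^ 'm2 ^ 'm1"
    and b :: "real ^ 'm1"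
    and x :: "nat \<Rightarrow> real ^ 'm2"
  assumes A_nonneg: "\<And>i j. A $ i $ j \<ge> 0"
    and b_pos: "\<And>i. b $ i > 0"
    and x0_pos: "\<And>j. x 0 $ j > 0"
    and x_Suc: "\<And>n j. x (Suc n) $ j =
      x n $ j / col_sum A j * (\<Sum>i\<in>UNIV. A $ i $ j * (b $ i / (A *v x n) $ i))"
  shows "decseq (\<lambda>n. KL b (A *v x (Suc n)))
    \<and> ((\<Sum>j\<in>UNIV. x 0 $ j * col_sum A j) = (\<Sum>i\<in>UNIV. b $ i)
         \<longrightarrow> decseq (\<lambda>n. KL b (A *v x n)))
    \<and> (\<lambda>n. KL b (A *v x n)) \<longlonglongrightarrow>
        (INF y \<in> {y. (\<forall>j. y $ j > 0)
                     \<and> (\<Sum>j\<in>UNIV. y $ j * col_sum A j) = (\<Sum>i\<in>UNIV. b $ i)}.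
           KL b (A *v y))"
proof (cases "\<forall>i. \<exists>j. A $ i $ j \<noteq> 0")
  case True
  then interpret positive_inverse_problem A b
    by unfold_locales (use A_nonneg b_pos in auto)
  have step: "x (Suc n) = em_step A b (x n)" for n
    by (simp add: vec_eq_iff em_step_def x_Suc)
  have adm: "admissible A (x n)" for n
  proof (induction n)
    case 0
    then show ?case using x0_pos by (simp add: admissible_def less_imp_le)
  qed (simp add: step admissible_em_step)
  have mass: "mass A (x (Suc n)) = total" for n
    by (simp add: step mass_em_step adm)
  have "decseq (\<lambda>n. KL b (A *v x n))" if "mass A (x 0) = total"
  proof (rule KL_em_iteration(1)[where z = x, OF adm _ step])
    show "mass A (x n) = total" for n
      using that mass by (cases n) auto
  qed
  \<comment> \<open>The shifted sequence is feasible throughout; dropping the first term does not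
    affect the limit.\<close>
  moreover note KL_em_iteration[where z = "\<lambda>n. x (Suc n)", OF adm mass step]
  ultimately show ?thesis
    unfolding mass_def by (auto dest: LIMSEQ_imp_Suc)
next
  case False
  then obtain i where "\<And>j. A $ i $ j = 0" by blast
  \<comment> \<open>With a zero row every value is infinite, and so is the infimum, even over an
    empty feasible set (as for \<open>A = 0\<close>).\<close>
  then have "KL b (A *v y) = top" for y
    using KL_eq_top[OF b_pos, of "A *v y" i] by (simp add: matrix_vector_mult_def top_ereal_def)
  then show ?thesis by (simp add: decseq_def)
qed

end
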